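(* Let $G$ be a pseudofinite $\mathfrak{M}_c$-group. If one of the Sylow $2$-subgroups of $G$ is finite, then all Sylow $2$-subgroups of $G$ are conjugate in $G$, and hence all of them are finite.
   Context: A group is a $2$-group if each of its elements has order $2^n$ for some natural number $n$ (the group may be infinite). A Sylow $2$-subgroup of a group $G$ is a maximal (with respect to inclusion) $2$-subgroup of $G$. A pseudofinite group is an infinite model of the theory of finite groups, i.e. an infinite group that satisfies every first-order sentence in the language of groups which is true in all finite groups. (Equivalently, an infinite group elementarily equivalent to a non-principal ultraproduct of finite groups.) A group $G$ is an $\mathfrak{M}_c$-group if it satisfies the descending chain condition on centralizers: every descending chain $C_G(X_1)\geqslant C_G(X_2)\geqslant\cdots$ of centralizers in $G$ of subsets $X_1, X_2,\ldots \subseteq G$ stabilizes after finitely many steps. *)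

theory Defs
  imports "HOL-Algebra.Algebra"
begin

datatype gterm = TVar nat | TOne | TInv gterm | TMult gterm gterm

text \<open>The other connectives and the existential quantifier are definable from these in the
  usual (classical) way.\<close>

datatype gform = FEq gterm gterm | FNeg gform | FConj gform gform | FAll nat gform

primrec term_vars :: "gterm \<Rightarrow> nat set" where
  "term_vars (TVar i) = {i}"
| "term_vars TOne = {}"
| "term_vars (TInv t) = term_vars t"
| "term_vars (TMult s t) = term_vars s \<union> term_vars t"

primrec free_vars :: "gform \<Rightarrow> nat set" where
  "free_vars (FEq s t) = term_vars s \<union> term_vars t"
| "free_vars (FNeg p) = free_vars p"
| "free_vars (FConj p q) = free_vars p \<union> free_vars q"
| "free_vars (FAll i p) = free_vars p - {i}"

definition sentence :: "gform \<Rightarrow> bool" where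
  "sentence p \<longleftrightarrow> free_vars p = {}"

primrec term_val :: "('a, 'b) monoid_scheme \<Rightarrow> (nat \<Rightarrow> 'a) \<Rightarrow> gterm \<Rightarrow> 'a" where
  "term_val G e (TVar i) = e i"
| "term_val G e TOne = \<one>\<^bsub>G\<^esub>"
| "term_val G e (TInv t) = inv\<^bsub>G\<^esub> (term_val G e t)"
| "term_val G e (TMult s t) = term_val G e s \<otimes>\<^bsub>G\<^esub> term_val G e t"

primrec sat :: "('a, 'b) monoid_scheme \<Rightarrow> (nat \<Rightarrow> 'a) \<Rightarrow> gform \<Rightarrow> bool" where
  "sat G e (FEq s t) \<longleftrightarrow> term_val G e s = term_val G e t"
| "sat G e (FNeg p) \<longleftrightarrow> \<not> sat G e p"
| "sat G e (FConj p q) \<longleftrightarrow> sat G e p \<and> sat G e q"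
| "sat G e (FAll i p) \<longleftrightarrow> (\<forall>a \<in> carrier G. sat G (e(i := a)) p)"

text \<open>For a sentence the choice of the assignment \<open>e\<close> is immaterial, see
  \<open>models_sentence_iff\<close>.\<close>

definition models :: "('a, 'b) monoid_scheme \<Rightarrow> gform \<Rightarrow> bool" where
  "models G p \<longleftrightarrow> (\<forall>e. range e \<subseteq> carrier G \<longrightarrow> sat G e p)"

text \<open>HOL cannot quantify over all types, so ``all finite groups'' means all finite groups whose
  carrier is a set of natural numbers. Every finite group is isomorphic to one of these; lemma
  \<open>true_in_finite_groups_models\<close> below confirms that nothing is lost.\<close>

definition true_in_finite_groups :: "gform \<Rightarrow> bool" where
  "true_in_finite_groups p \<longleftrightarrow>
     (\<forall>H :: nat monoid. group H \<and> finite (carrier H) \<longrightarrow> models H p)"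

definition pseudofinite_group :: "('a, 'b) monoid_scheme \<Rightarrow> bool" where
  "pseudofinite_group G \<longleftrightarrow>
     group G \<and> infinite (carrier G) \<and>
     (\<forall>p. sentence p \<and> true_in_finite_groups p \<longrightarrow> models G p)"

lemma term_val_closed:
  assumes "group G" "range e \<subseteq> carrier G"
  shows "term_val G e t \<in> carrier G"
proof -
  interpret group G by fact
  have "e i \<in> carrier G" for i using assms(2) by blast
  then show ?thesis by (induction t) auto
qed

lemma sat_cong:
  assumes "\<And>i. i \<in> free_vars p \<Longrightarrow> e i = e' i"
  shows "sat G e p \<longleftrightarrow> sat G e' p"
proof -
  have tv: "(\<And>i. i \<in> term_vars t \<Longrightarrow> d i = d' i) \<Longrightarrow> term_val G d t = term_val G d' t"
    for t d d' by (induction t) auto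
  show ?thesis using assms
  proof (induction p arbitrary: e e')
    case (FEq s t)
    then show ?case using tv[of s e e'] tv[of t e e'] by simp
  next
    case (FNeg p)
    then have "sat G e p \<longleftrightarrow> sat G e' p" by (intro FNeg.IH) auto
    then show ?case by simp
  next
    case (FConj p q)
    have "sat G e p \<longleftrightarrow> sat G e' p" by (rule FConj.IH(1)) (use FConj.prems in auto)
    moreover have "sat G e q \<longleftrightarrow> sat G e' q" by (rule FConj.IH(2)) (use FConj.prems in auto)
    ultimately show ?case by simp
  next
    case (FAll i p)
    have "sat G (e(i := a)) p \<longleftrightarrow> sat G (e'(i := a)) p" for a
      by (rule FAll.IH) (use FAll.prems in auto)
    then show ?case by simp
  qed
qed

lemma models_sentence_iff:
  assumes "sentence p" "range e \<subseteq> carrier G"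
  shows "models G p \<longleftrightarrow> sat G e p"
  using assms sat_cong[of p] unfolding models_def sentence_def by blast

lemma sat_iso:
  assumes G: "group G" and H: "group H" and h: "h \<in> iso G H" and e: "range e \<subseteq> carrier G"
  shows "sat G e p \<longleftrightarrow> sat H (h \<circ> e) p"
proof -
  interpret group_hom G H h
    using G H h by (simp add: group_hom_def group_hom_axioms_def iso_def)
  have inj: "inj_on h (carrier G)" and surj: "h ` carrier G = carrier H"
    using h by (auto simp: iso_def bij_betw_def)
  have tv: "h (term_val G d t) = term_val H (h \<circ> d) t" if "range d \<subseteq> carrier G" for d t
    using that by (induction t) (auto simp: term_val_closed[OF G])
  show ?thesis using e
  proof (induction p arbitrary: e)
    case (FEq s t)
    then show ?case
      using tv[of e] inj_on_eq_iff[OF inj, of "term_val G e s" "term_val G e t"]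
      by (metis sat.simps(1) term_val_closed[OF G])
  next
    case (FAll i p)
    have "sat G (e(i := a)) p \<longleftrightarrow> sat H ((h \<circ> e)(i := h a)) p" if "a \<in> carrier G" for a
    proof -
      have "range (e(i := a)) \<subseteq> carrier G" using FAll.prems that by auto
      moreover have "h \<circ> e(i := a) = (h \<circ> e)(i := h a)" by auto
      ultimately show ?thesis using FAll.IH[of "e(i := a)"] by metis
    qed
    then show ?case unfolding sat.simps surj[symmetric] by blast
  qed auto
qed

lemma true_in_finite_groups_models:
  fixes G :: "('a, 'b) monoid_scheme"
  assumes p: "sentence p" "true_in_finite_groups p" and G: "group G" "finite (carrier G)"
  shows "models G p"
proof -
  interpret group G by fact
  obtain f :: "'a \<Rightarrow> nat" where f: "inj_on f (carrier G)"
    using G(2) finite_imp_inj_to_nat_seg by blast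
  define g where "g = inv_into (carrier G) f"
  have gf [simp]: "g (f x) = x" if "x \<in> carrier G" for x
    using f that by (simp add: g_def)
  define H where
    "H = \<lparr>carrier = f ` carrier G, monoid.mult = (\<lambda>x y. f (g x \<otimes>\<^bsub>G\<^esub> g y)), one = f \<one>\<^bsub>G\<^esub>\<rparr>"
  have H: "group H"
  proof (rule groupI)
    fix x assume "x \<in> carrier H"
    then obtain a where "a \<in> carrier G" "x = f a" by (auto simp: H_def)
    then show "\<exists>y\<in>carrier H. y \<otimes>\<^bsub>H\<^esub> x = \<one>\<^bsub>H\<^esub>"
      by (intro bexI[of _ "f (inv\<^bsub>G\<^esub> a)"]) (auto simp: H_def)
  qed (auto simp: H_def m_assoc)
  have h: "f \<in> iso G H"
    using f by (auto simp: iso_def hom_def H_def bij_betw_def)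
  have "models H p"
    using p(2) H G(2) by (simp add: true_in_finite_groups_def H_def)
  then have "sat H (f \<circ> e) p" if "range e \<subseteq> carrier G" for e
  proof -
    have "range (f \<circ> e) \<subseteq> carrier H" using that by (auto simp: H_def)
    with \<open>models H p\<close> show ?thesis unfolding models_def by blast
  qed
  then show ?thesis
    unfolding models_def using sat_iso[OF G(1) H h] by blast
qed

definition centralizer :: "('a, 'b) monoid_scheme \<Rightarrow> 'a set \<Rightarrow> 'a set" where
  "centralizer G S = {g \<in> carrier G. \<forall>x \<in> S. g \<otimes>\<^bsub>G\<^esub> x = x \<otimes>\<^bsub>G\<^esub> g}"

definition mc_group :: "('a, 'b) monoid_scheme \<Rightarrow> bool" where
  "mc_group G \<longleftrightarrow>
     group G \<and>
     (\<forall>S :: nat \<Rightarrow> 'a set.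
        (\<forall>n. S n \<subseteq> carrier G) \<and>
        (\<forall>n. centralizer G (S (Suc n)) \<subseteq> centralizer G (S n)) \<longrightarrow>
        (\<exists>N. \<forall>n \<ge> N. centralizer G (S n) = centralizer G (S N)))"

text \<open>\<^const>\<open>group.ord\<close> is \<open>0\<close> on elements of infinite order, so these are excluded.\<close>

definition two_group :: "('a, 'b) monoid_scheme \<Rightarrow> bool" where
  "two_group P \<longleftrightarrow> group P \<and> (\<forall>x \<in> carrier P. \<exists>n. group.ord P x = 2 ^ n)"

definition two_subgroup :: "('a, 'b) monoid_scheme \<Rightarrow> 'a set \<Rightarrow> bool" where
  "two_subgroup G P \<longleftrightarrow> subgroup P G \<and> two_group (G\<lparr>carrier := P\<rparr>)"

definition sylow_two_subgroup :: "('a, 'b) monoid_scheme \<Rightarrow> 'a set \<Rightarrow> bool" where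
  "sylow_two_subgroup G P \<longleftrightarrow>
     two_subgroup G P \<and> (\<forall>Q. two_subgroup G Q \<and> P \<subseteq> Q \<longrightarrow> Q = P)"

definition conjugate_in :: "('a, 'b) monoid_scheme \<Rightarrow> 'a set \<Rightarrow> 'a set \<Rightarrow> bool" where
  "conjugate_in G P Q \<longleftrightarrow> (\<exists>g \<in> carrier G. Q = (g <#\<^bsub>G\<^esub> P) #>\<^bsub>G\<^esub> (inv\<^bsub>G\<^esub> g))"

end

theory Submission
  imports Defs
begin

text \<open>
  Call a \<open>2\<close>-subgroup \<open>U\<close> of a group quadratically closed (\<open>no_quadratic_extension\<close>) if no \<open>z\<close>
  outside \<open>U\<close> normalises \<open>U\<close> and has its square in \<open>U\<close>. A Sylow \<open>2\<close>-subgroup \<open>S\<close> has this property, since otherwise \<open>S\<close> together with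
  \<open>z\<close> generates a larger \<open>2\<close>-subgroup (\<open>sylow_two_subgroup_no_quadratic_extension\<close>). Unlike
  maximality, which speaks of all subgroups, this property of a finite set \<open>U\<close> is first-order.

  In a finite group a quadratically closed \<open>2\<close>-subgroup \<open>U\<close> is a Sylow subgroup in the arithmetical
  sense, because a proper subgroup of a finite \<open>2\<close>-group is always enlarged by some such \<open>z\<close>; hence
  every \<open>2\<close>-subgroup is conjugate into \<open>U\<close> (\<open>finite_group_conj_into\<close>). For prescribed sizes of \<open>U\<close>
  and of the other subgroup this is a sentence true in all finite groups, so it holds in the
  pseudofinite group: every finite \<open>2\<close>-subgroup is conjugate into \<open>S\<close>
  (\<open>pseudofinite_conj_into\<close>). In particular its order is at most that of \<open>S\<close>.

  It remains to see that an arbitrary \<open>2\<close>-subgroup \<open>P\<close> is finite once its finite subgroups have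
  bounded order (\<open>finite_two_subgroup_if_bounded\<close>). Take a finite subgroup \<open>F\<close> of largest order
  and, if \<open>F \<noteq> P\<close>, a finite subgroup \<open>F'\<close> not inside \<open>F\<close> for which \<open>D = F \<inter> F'\<close> is as large as
  possible. Both \<open>F\<close> and \<open>F'\<close> contain an element outside \<open>D\<close>, say \<open>a\<close> and \<open>b\<close>, that is an involution modulo
  \<open>D\<close> in the normaliser of \<open>D\<close>. Two involutions whose product has finite order generate a finite
  dihedral group, so \<open>D\<close>, \<open>a\<close> and \<open>b\<close> lie in a finite subgroup of \<open>P\<close>; it meets \<open>F\<close> in more than \<open>D\<close>
  and is not inside \<open>F\<close>, contrary to the choice of \<open>F'\<close>.

  Finally, if \<open>P\<close> is a Sylow \<open>2\<close>-subgroup, then it is finite, hence contained in a conjugate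
  of \<open>S\<close>, and equal to it by maximality.
\<close>

section \<open>\<open>2\<close>-subgroups and their orders\<close>

context group begin

text \<open>In this form being a \<open>2\<close>-group no longer refers to element orders computed inside the
  subgroup, and it can be written as a first-order formula once the exponent is bounded.\<close>

lemma two_subgroup_iff:
  "two_subgroup G P \<longleftrightarrow> subgroup P G \<and> (\<forall>x\<in>P. \<exists>n::nat. x [^] (2 ^ n :: nat) = \<one>)"
proof (cases "subgroup P G")
  case True
  then interpret P: group "G\<lparr>carrier := P\<rparr>"
    by (simp add: subgroup_imp_group)
  have "(\<exists>n. P.ord x = 2 ^ n) \<longleftrightarrow> (\<exists>n::nat. x [^] (2 ^ n :: nat) = \<one>)" if "x \<in> P" for x
  proof -
    have "x [^] n = \<one> \<longleftrightarrow> P.ord x dvd n" for n :: nat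
      using P.pow_eq_id[of x n] that by (simp flip: nat_pow_consistent)
    then show ?thesis
      using divides_primepow_nat[OF two_is_prime_nat, of "P.ord x"] by auto
  qed
  then show ?thesis
    using True P.group_axioms by (auto simp: two_subgroup_def two_group_def)
qed (simp add: two_subgroup_def)

lemma two_subgroup_imp_subgroup: "two_subgroup G P \<Longrightarrow> subgroup P G"
  by (simp add: two_subgroup_def)

lemma two_subgroup_subset:
  assumes "two_subgroup G P" "subgroup Q G" "Q \<subseteq> P"
  shows "two_subgroup G Q"
  using assms by (auto simp: two_subgroup_iff)

text \<open>A Sylow \<open>p\<close>-subgroup exists for each prime divisor \<open>p\<close> of the order, so an odd \<open>p\<close> would yield
  elements of odd order.\<close>

lemma order_finite_two_group:
  assumes "two_group G" "finite (carrier G)"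
  shows "\<exists>n. order G = 2 ^ n"
proof -
  have pos: "order G > 0"
    using assms(2) order_gt_0_iff_finite by blast
  have only_2: "p = 2" if p: "Factorial_Ring.prime p" "p dvd order G" for p
  proof (rule ccontr)
    assume "p \<noteq> 2"
    \<comment> \<open>Exponent 1 suffices: a subgroup of order \<open>p\<close> consists of elements of order \<open>1\<close> or \<open>p\<close>.\<close>
    obtain m where "order G = p ^ 1 * m"
      using p(2) by (metis dvdE power_one_right)
    then obtain H where H: "subgroup H G" "card H = p"
      using sylow_thm[OF p(1) group_axioms _ assms(2)] by fastforce
    have "H \<noteq> {\<one>}"
      using H(2) p(1) prime_gt_1_nat[of p] by auto
    then obtain x where x: "x \<in> H" "x \<noteq> \<one>"
      using subgroup.one_closed[OF H(1)] by blast
    have xG: "x \<in> carrier G" using subgroup.mem_carrier[OF H(1) x(1)] .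
    interpret H: group "G\<lparr>carrier := H\<rparr>" by (simp add: H subgroup_imp_group)
    have "x [^] p = \<one>"
      using H.pow_order_eq_1[of x] x H by (simp add: order_def flip: nat_pow_consistent)
    then have "ord x dvd p" using xG pow_eq_id by blast
    then have "ord x = p" using p(1) xG x(2) ord_eq_1[of x] by (auto simp: prime_nat_iff)
    moreover obtain n where "ord x = 2 ^ n"
      using assms(1) xG by (auto simp: two_group_def)
    ultimately have "p dvd 2 ^ n" by simp
    then show False
      using p(1) \<open>p \<noteq> 2\<close> by (meson prime_dvd_power primes_dvd_imp_eq two_is_prime_nat)
  qed
  then show ?thesis
  proof -
    obtain m where m: "order G = m * 2 ^ multiplicity 2 (order G)" "\<not> 2 dvd m"
      using pos multiplicity_decompose'[of "order G" "2::nat"] by (auto simp: mult.commute)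
    have "m = 1"
    proof (rule ccontr)
      assume "m \<noteq> 1"
      then obtain p where "Factorial_Ring.prime p" "p dvd m" using prime_factor_nat by blast
      then show False using only_2[of p] m by (metis dvd_mult2)
    qed
    then show ?thesis using m(1) by auto
  qed
qed

section \<open>Counting fixed points modulo 2\<close>

lemma card_orbit_eq_1_or_even:
  assumes "group_action G E \<phi>" "order G = 2 ^ n" "x \<in> E"
  shows "orbit G \<phi> x = {x} \<or> even (card (orbit G \<phi> x))"
proof -
  interpret group_action G E \<phi> by fact
  have "card (orbit G \<phi> x) dvd 2 ^ n"
    using orbit_stabilizer_theorem[OF assms(3)] assms(2) by (metis dvd_triv_left)
  then obtain k where k: "card (orbit G \<phi> x) = 2 ^ k"
    by (meson divides_primepow_nat two_is_prime_nat)
  show ?thesis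
  proof (cases k)
    case 0
    then have "card (orbit G \<phi> x) = 1" using k by simp
    then obtain y where "orbit G \<phi> x = {y}" by (auto simp: card_1_singleton_iff)
    then show ?thesis using orbit_refl[OF assms(3)] by auto
  qed (use k in auto)
qed

text \<open>Every orbit other than that of a fixed point has even size, so it does not affect parity.\<close>

lemma even_card_iff_even_card_fixed_points:
  assumes "group_action G E \<phi>" "order G = 2 ^ n" "finite E"
  shows "even (card E) \<longleftrightarrow> even (card {x \<in> E. \<forall>g \<in> carrier G. \<phi> g x = x})"
proof -
  interpret group_action G E \<phi> by fact
  define F where "F = {x \<in> E. \<forall>g \<in> carrier G. \<phi> g x = x}"
  have FE: "F \<subseteq> E" and finF: "finite F" using assms(3) by (auto simp: F_def)
  have fix_iff: "orbit G \<phi> x = {x} \<longleftrightarrow> x \<in> F" if "x \<in> E" for x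
    using that orbit_refl[OF that] by (auto simp: F_def orbit_def)
  have finO: "finite (orbits G E \<phi>)"
    using assms(3) by (auto simp: orbits_def)
  \<comment> \<open>Compare \<open>E\<close> and its set of fixed points orbit by orbit.\<close>
  have parity: "even ((\<Sum>x\<in>orb. 1::nat) - (\<Sum>x\<in>orb. if x \<in> F then 1 else 0)) \<and>
      (\<Sum>x\<in>orb. if x \<in> F then 1 else 0) \<le> (\<Sum>x\<in>orb. 1::nat)"
    if orb: "orb \<in> orbits G E \<phi>" for orb
  proof -
    obtain x where x: "x \<in> E" "orb = orbit G \<phi> x" using orb by (auto simp: orbits_def)
    show ?thesis
    proof (cases "x \<in> F")
      case True
      then show ?thesis using fix_iff[OF x(1)] x by simp
    next
      case False
      have "y \<notin> F" if "y \<in> orb" for y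
      proof
        assume "y \<in> F"
        moreover have "y \<in> E" using \<open>y \<in> F\<close> FE by blast
        moreover have "x \<in> orbit G \<phi> y" using that x orbit_sym[OF x(1) \<open>y \<in> E\<close>] by simp
        ultimately show False using fix_iff[of y] False by auto
      qed
      then have "(\<Sum>x\<in>orb. if x \<in> F then 1 else (0::nat)) = 0" by (simp add: sum.neutral)
      then show ?thesis
        using card_orbit_eq_1_or_even[OF assms(1,2) x(1)] fix_iff[OF x(1)] False x(2) by simp
    qed
  qed
  have "card E = (\<Sum>orb\<in>orbits G E \<phi>. \<Sum>x\<in>orb. 1)"
    using disjoint_sum[OF assms(3), of "\<lambda>_. 1::nat"] by simp
  moreover have "card F = (\<Sum>orb\<in>orbits G E \<phi>. \<Sum>x\<in>orb. if x \<in> F then 1 else 0)"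
    using disjoint_sum[OF assms(3), of "\<lambda>x. if x \<in> F then 1 else (0::nat)"] assms(3) FE
    by (simp add: sum.If_cases Int_absorb1)
  ultimately have "card E - card F = (\<Sum>orb\<in>orbits G E \<phi>. (\<Sum>x\<in>orb. 1) - (\<Sum>x\<in>orb. if x \<in> F then 1 else 0))"
    using parity by (simp add: sum_subtractf_nat)
  then have "even (card E - card F)"
    using parity by (simp add: dvd_sum)
  moreover have "card F \<le> card E" using FE assms(3) card_mono by blast
  ultimately show ?thesis unfolding F_def by simp
qed

lemma two_subgroup_card:
  assumes "two_subgroup G P" "finite P"
  shows "\<exists>n. card P = 2 ^ n"
  using group.order_finite_two_group[of "G\<lparr>carrier := P\<rparr>"] assms
  by (auto simp: two_subgroup_def order_def two_group_def)

text \<open>The parity principle for right translation; in its uses \<open>E\<close> consists of right cosets. A coset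
  \<open>T #> g\<close> fixed by all of \<open>Y\<close> means that \<open>g\<close> conjugates \<open>Y\<close> into \<open>T\<close>.\<close>

lemma even_card_iff_even_card_fixed_cosets:
  assumes Y: "two_subgroup G Y" "finite Y" and E: "finite E" "E \<subseteq> Pow (carrier G)"
    and inv: "\<And>C y. C \<in> E \<Longrightarrow> y \<in> Y \<Longrightarrow> C #> y \<in> E"
  shows "even (card E) \<longleftrightarrow> even (card {C \<in> E. \<forall>y \<in> Y. C #> y = C})"
proof -
  \<comment> \<open>The inverse turns right translation into an action from the left.\<close>
  define \<phi> where "\<phi> = (\<lambda>y. \<lambda>C \<in> E. C #> inv y)"
  have sub: "subgroup Y G" using Y by (simp add: two_subgroup_def)
  interpret Y: subgroup Y G by fact
  interpret GY: group "G\<lparr>carrier := Y\<rparr>" by (simp add: sub subgroup_imp_group)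
  have cos: "C #> y #> z = C #> (y \<otimes> z)" if "C \<in> E" "y \<in> Y" "z \<in> Y" for C y z
    using that E by (intro coset_mult_assoc) auto
  have one: "C #> \<one> = C" if "C \<in> E" for C
    using that E by (intro coset_mult_one) auto
  have bij: "\<phi> y \<in> Bij E" if "y \<in> Y" for y
  proof -
    have "bij_betw (\<phi> y) E E"
      by (rule bij_betwI[where g = "\<lambda>C. C #> y"])
        (use that inv in \<open>auto simp: \<phi>_def cos one\<close>)
    then show ?thesis by (simp add: Bij_def \<phi>_def)
  qed
  have "\<phi> \<in> hom (G\<lparr>carrier := Y\<rparr>) (BijGroup E)"
  proof (rule homI)
    fix y z assume "y \<in> carrier (G\<lparr>carrier := Y\<rparr>)" "z \<in> carrier (G\<lparr>carrier := Y\<rparr>)"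
    then have yz: "y \<in> Y" "z \<in> Y" by auto
    then show "\<phi> (y \<otimes>\<^bsub>G\<lparr>carrier := Y\<rparr>\<^esub> z) = \<phi> y \<otimes>\<^bsub>BijGroup E\<^esub> \<phi> z"
      using bij inv by (auto simp: BijGroup_def compose_def \<phi>_def fun_eq_iff cos inv_mult_group)
  qed (auto simp: BijGroup_def bij)
  then have act: "group_action (G\<lparr>carrier := Y\<rparr>) E \<phi>"
    by (simp add: group_action_def group_hom_def group_hom_axioms_def GY.group_axioms group_BijGroup)
  obtain n where n: "order (G\<lparr>carrier := Y\<rparr>) = 2 ^ n"
    using two_subgroup_card[OF Y] by (auto simp: order_def)
  have "{x \<in> E. \<forall>g\<in>carrier (G\<lparr>carrier := Y\<rparr>). \<phi> g x = x} = {C \<in> E. \<forall>y \<in> Y. C #> y = C}"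
    by (force simp: \<phi>_def dest: bspec[OF _ Y.m_inv_closed])
  then show ?thesis
    using GY.even_card_iff_even_card_fixed_points[OF act n E(1)] by simp
qed

text \<open>An odd number of cosets forces a fixed one.\<close>

lemma conj_into_odd_index:
  assumes T: "subgroup T G" "odd (card (rcosets T))" and Y: "two_subgroup G Y" "finite Y"
  shows "\<exists>g \<in> carrier G. \<forall>y \<in> Y. g \<otimes> y \<otimes> inv g \<in> T"
proof -
  have Yc: "Y \<subseteq> carrier G" using Y by (simp add: two_subgroup_iff subgroup.subset)
  have "rcosets T \<subseteq> Pow (carrier G)" using T by (auto dest: subgroup.rcosets_carrier[OF _ group_axioms])
  moreover have "C #> y \<in> rcosets T" if "C \<in> rcosets T" "y \<in> Y" for C y
  proof -
    from that(1) obtain g where "g \<in> carrier G" "C = T #> g" by (auto simp: RCOSETS_def)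
    moreover have "y \<in> carrier G" using that(2) Yc by blast
    ultimately show ?thesis
      using coset_mult_assoc[OF subgroup.subset[OF T(1)]] rcosetsI[OF subgroup.subset[OF T(1)]] by simp
  qed
  moreover have "finite (rcosets T)"
    using T(2) by (intro card_ge_0_finite odd_pos)
  ultimately have "odd (card {C \<in> rcosets T. \<forall>y \<in> Y. C #> y = C})"
    using even_card_iff_even_card_fixed_cosets[OF Y, of "rcosets T"] T(2) by blast
  then have "{C \<in> rcosets T. \<forall>y \<in> Y. C #> y = C} \<noteq> {}"
    by (intro notI) simp
  then obtain C where C: "C \<in> rcosets T" "\<forall>y \<in> Y. C #> y = C" by blast
  then obtain g where g: "g \<in> carrier G" "C = T #> g" by (auto simp: RCOSETS_def)
  have "g \<otimes> y \<otimes> inv g \<in> T" if "y \<in> Y" for y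
  proof -
    have y: "y \<in> carrier G" using that Yc by blast
    have "T #> (g \<otimes> y) = T #> g"
      using C(2) that g y T(1) by (metis coset_mult_assoc subgroup.subset)
    then have "g \<otimes> y \<in> T #> g"
      using T(1) g y by (metis m_closed rcos_self)
    then show ?thesis using T(1) g y by (meson subgroup.rcos_module_imp group_axioms)
  qed
  then show ?thesis using g(1) by blast
qed

text \<open>\<open>D\<close> acts on its own cosets in \<open>U\<close>. Their number is even and the coset \<open>D\<close> is fixed, so there is a
  second fixed coset \<open>D #> g\<close>, and \<open>g\<close> normalises \<open>D\<close>. Repeated squaring of \<open>g\<close> ends in \<open>D\<close>; \<open>z\<close>
  is the element just before \<open>D\<close> is first reached.\<close>

lemma two_subgroup_normalizer_growth:
  assumes U: "two_subgroup G U" "finite U" and D: "subgroup D G" "D \<subset> U"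
  shows "\<exists>z \<in> U - D. z \<otimes> z \<in> D \<and> (\<forall>d \<in> D. z \<otimes> d \<otimes> inv z \<in> D)"
proof -
  have sX: "subgroup U G" using U by (simp add: two_subgroup_def)
  interpret U: subgroup U G by fact
  interpret D: subgroup D G by fact
  interpret GX: group "G\<lparr>carrier := U\<rparr>" by (simp add: sX subgroup_imp_group)
  have DX: "subgroup D (G\<lparr>carrier := U\<rparr>)" using D sX by (intro subgroup_incl) auto
  have two_D: "two_subgroup G D" using two_subgroup_subset U(1) D by blast
  have finD: "finite D" using U(2) D(2) finite_subset by blast
  define E where "E = (\<lambda>x. D #> x) ` U"
  have finE: "finite E" using U(2) by (simp add: E_def)
  have E_rcosets: "E = rcosets\<^bsub>G\<lparr>carrier := U\<rparr>\<^esub> D"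
    by (auto simp: E_def RCOSETS_def r_coset_def)
  have "card E * card D = card U"
    using GX.lagrange[OF DX] E_rcosets by (simp add: order_def)
  moreover have "card D < card U" using D(2) U(2) psubset_card_mono by blast
  moreover obtain k where "card U = 2 ^ k" using two_subgroup_card[OF U] by blast
  moreover obtain j where "card E = 2 ^ j"
    using calculation divides_primepow_nat[OF two_is_prime_nat, of "card E" k]
    by (metis dvd_triv_left)
  ultimately have "even (card E)" by (cases j) auto
  moreover have "E \<subseteq> Pow (carrier G)" by (auto simp: E_def r_coset_def)
  moreover have inv: "C #> y \<in> E" if "C \<in> E" "y \<in> D" for C y
  proof -
    from that(1) obtain x where x: "x \<in> U" "C = D #> x" by (auto simp: E_def)
    have "y \<in> U" using that(2) D(2) by blast
    then have "C #> y = D #> (x \<otimes> y)" using x coset_mult_assoc[OF D.subset] by simp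
    then show ?thesis using x \<open>y \<in> U\<close> by (simp add: E_def)
  qed
  ultimately have "even (card {C \<in> E. \<forall>y \<in> D. C #> y = C})"
    using even_card_iff_even_card_fixed_cosets[OF two_D finD finE] by blast
  moreover have "D \<in> {C \<in> E. \<forall>y \<in> D. C #> y = C}"
    unfolding E_def using D.subset D(1) coset_join2 by (auto intro!: image_eqI[of _ _ \<one>] simp: coset_mult_one)
  moreover from calculation have "{C \<in> E. \<forall>y \<in> D. C #> y = C} \<noteq> {D}" by auto
  ultimately obtain C where C: "C \<in> E" "\<forall>y \<in> D. C #> y = C" "C \<noteq> D" by blast
  then obtain g where g: "g \<in> U" "C = D #> g" by (auto simp: E_def)
  have gG: "g \<in> carrier G" using g by simp
  have gD: "g \<notin> D" using C(3) g(2) D(1) coset_join2 gG by blast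
  have conj: "g \<otimes> y \<otimes> inv g \<in> D" if "y \<in> D" for y
  proof -
    have "D #> (g \<otimes> y) = D #> g"
      using C(2) that g gG by (metis coset_mult_assoc D.subset D.mem_carrier)
    then have "g \<otimes> y \<in> D #> g"
      using D(1) gG that by (metis D.mem_carrier m_closed rcos_self)
    then show ?thesis using D(1) gG that by (meson D.mem_carrier subgroup.rcos_module_imp group_axioms)
  qed
  define z where "z k = g [^] (2 ^ k :: nat)" for k :: nat
  have z_Suc: "z (Suc k) = z k \<otimes> z k" for k
    using gG by (simp add: z_def nat_pow_mult mult_2)
  have zX: "z k \<in> U" for k
    by (induction k) (use g gG z_Suc in \<open>auto simp: z_def\<close>)
  have zD: "\<forall>d \<in> D. z k \<otimes> d \<otimes> inv (z k) \<in> D" for k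
  proof (induction k)
    case 0
    then show ?case using conj gG by (simp add: z_def)
  next
    case (Suc k)
    have zG: "z k \<in> carrier G" using zX[of k] by simp
    have "z (Suc k) \<otimes> d \<otimes> inv (z (Suc k)) = z k \<otimes> (z k \<otimes> d \<otimes> inv (z k)) \<otimes> inv (z k)"
      if "d \<in> D" for d
      using zG that by (simp add: z_Suc m_assoc inv_mult_group)
    then show ?case using Suc by simp
  qed
  obtain n where "z n = \<one>"
    using U(1) g(1) unfolding two_subgroup_iff z_def by blast
  then have "\<exists>k. z k \<in> D" by (metis D.one_closed)
  then have "z (LEAST k. z k \<in> D) \<in> D" by (rule LeastI_ex)
  moreover obtain k where k: "(LEAST k. z k \<in> D) = Suc k"
    using calculation gD gG by (cases "LEAST k. z k \<in> D") (auto simp: z_def)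
  moreover have "z k \<notin> D" using k not_less_Least[of k "\<lambda>k. z k \<in> D"] by simp
  ultimately show ?thesis using zX zD z_Suc by (metis DiffI)
qed

section \<open>Conjugates of \<open>2\<close>-subgroups\<close>

lemma conj_nat_pow:
  assumes "g \<in> carrier G" "x \<in> carrier G"
  shows "(g \<otimes> x \<otimes> inv g) [^] (n::nat) = g \<otimes> x [^] n \<otimes> inv g"
proof (induction n)
  case (Suc n)
  have "(g \<otimes> x \<otimes> inv g) [^] Suc n = (g \<otimes> x [^] n \<otimes> inv g) \<otimes> (g \<otimes> x \<otimes> inv g)"
    using Suc by simp
  also have "\<dots> = g \<otimes> x [^] n \<otimes> ((inv g \<otimes> g) \<otimes> (x \<otimes> inv g))"
    using assms by (simp only: m_assoc inv_closed m_closed nat_pow_closed)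
  also have "\<dots> = g \<otimes> x [^] Suc n \<otimes> inv g"
    using assms by (simp add: m_assoc)
  finally show ?case .
qed (use assms in simp)

lemma conj_subset_eq_image:
  "(g <# P) #> inv g = (\<lambda>x. g \<otimes> x \<otimes> inv g) ` P"
  by (auto simp: l_coset_def r_coset_def)

lemma two_subgroup_conj:
  assumes "two_subgroup G P" "g \<in> carrier G"
  shows "two_subgroup G ((\<lambda>x. g \<otimes> x \<otimes> inv g) ` P)"
proof -
  have P: "subgroup P G" using assms(1) by (rule two_subgroup_imp_subgroup)
  have "subgroup ((\<lambda>x. g \<otimes> x \<otimes> inv g) ` P) G"
    using subgroup_conjugation_is_surj2[OF assms(2) P] by (simp add: conj_subset_eq_image)
  moreover have "\<exists>n::nat. (g \<otimes> x \<otimes> inv g) [^] (2 ^ n :: nat) = \<one>" if "x \<in> P" for x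
  proof -
    obtain n :: nat where "x [^] (2 ^ n :: nat) = \<one>"
      using assms(1) \<open>x \<in> P\<close> by (auto simp: two_subgroup_iff)
    then show ?thesis
      using assms(2) subgroup.mem_carrier[OF P \<open>x \<in> P\<close>] by (auto simp: conj_nat_pow intro: exI[of _ n])
  qed
  ultimately show ?thesis by (auto simp: two_subgroup_iff)
qed

section \<open>Adjoining an element of the normaliser\<close>

text \<open>When \<open>c\<close> normalises the subgroup \<open>D\<close> and has finite order, this is the subgroup generated
  by \<open>D\<close> and \<open>c\<close>. Exponents are natural numbers, so closure under inverses rests on the finite order.\<close>

definition adjoin :: "'a set \<Rightarrow> 'a \<Rightarrow> 'a set" where
  "adjoin D c = {d \<otimes> c [^] i | d i::nat. d \<in> D}"

lemma nat_pow_normalizes: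
  assumes "subgroup D G" "c \<in> carrier G" "\<And>d. d \<in> D \<Longrightarrow> c \<otimes> d \<otimes> inv c \<in> D" "d \<in> D"
  shows "c [^] (i::nat) \<otimes> d \<otimes> inv (c [^] i) \<in> D"
  using assms(4)
proof (induction i arbitrary: d)
  case (Suc i)
  have d: "d \<in> carrier G" using Suc.prems assms(1) subgroup.mem_carrier by metis
  have "c [^] Suc i \<otimes> d \<otimes> inv (c [^] Suc i) = c [^] i \<otimes> (c \<otimes> d \<otimes> inv c) \<otimes> inv (c [^] i)"
    using d assms(2) by (simp add: m_assoc inv_mult_group)
  then show ?case using Suc assms(3) by simp
qed (use subgroup.mem_carrier[OF assms(1)] in simp)

text \<open>Moving \<open>e\<close> to the left of the power of \<open>c\<close> replaces it by a conjugate, which lies in \<open>D\<close> again if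
  \<open>c\<close> normalises \<open>D\<close>.\<close>

lemma adjoin_mult:
  assumes "subgroup D G" "c \<in> carrier G" "d \<in> D" "e \<in> D"
  shows "(d \<otimes> c [^] (i::nat)) \<otimes> (e \<otimes> c [^] (j::nat)) =
    (d \<otimes> (c [^] i \<otimes> e \<otimes> inv (c [^] i))) \<otimes> c [^] (i + j)"
proof -
  have [simp]: "d \<in> carrier G" "e \<in> carrier G"
    using assms subgroup.mem_carrier by metis+
  have "inv (c [^] i) \<otimes> c [^] (i + j) = c [^] j"
    using assms(2) by (simp add: inv_solve_left' nat_pow_mult)
  then show ?thesis using assms(2) by (simp add: m_assoc)
qed

lemma subset_adjoin: "subgroup D G \<Longrightarrow> D \<subseteq> adjoin D c"
  by (force simp: adjoin_def subgroup.mem_carrier intro: exI[of _ "0::nat"])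

lemma in_adjoin: "subgroup D G \<Longrightarrow> c \<in> carrier G \<Longrightarrow> c \<in> adjoin D c"
  unfolding adjoin_def using subgroup.one_closed[of D G]
  by (auto intro!: exI[of _ \<one>] exI[of _ "1::nat"])

lemma nat_pow_in_subgroup: "subgroup P G \<Longrightarrow> c \<in> P \<Longrightarrow> c [^] (i::nat) \<in> P"
  by (induction i) (auto simp: subgroup.one_closed subgroup.m_closed)

lemma adjoin_subset: "subgroup P G \<Longrightarrow> D \<subseteq> P \<Longrightarrow> c \<in> P \<Longrightarrow> adjoin D c \<subseteq> P"
  by (auto simp: adjoin_def nat_pow_in_subgroup subgroup.m_closed subsetD)

lemma subgroup_adjoin:
  assumes D: "subgroup D G" and c: "c \<in> carrier G" "\<And>d. d \<in> D \<Longrightarrow> c \<otimes> d \<otimes> inv c \<in> D"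
    and n: "c [^] (n::nat) = \<one>" "n > 0"
  shows "subgroup (adjoin D c) G"
proof (rule subgroupI)
  interpret D: subgroup D G by fact
  have closed: "x \<otimes> y \<in> adjoin D c" if x: "x \<in> adjoin D c" and y: "y \<in> adjoin D c" for x y
  proof -
    obtain d and i :: nat where 1: "d \<in> D" "x = d \<otimes> c [^] i" using x by (auto simp: adjoin_def)
    obtain e and j :: nat where 2: "e \<in> D" "y = e \<otimes> c [^] j" using y by (auto simp: adjoin_def)
    show ?thesis
      unfolding 1 2 adjoin_mult[OF D c(1) 1(1) 2(1)]
      using nat_pow_normalizes[OF D c 2(1), of i] 1(1) D.m_closed unfolding adjoin_def by blast
  qed
  show "adjoin D c \<subseteq> carrier G" using c(1) by (auto simp: adjoin_def)
  show "adjoin D c \<noteq> {}" using in_adjoin[OF D c(1)] by blast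
  show "x \<otimes> y \<in> adjoin D c" if "x \<in> adjoin D c" "y \<in> adjoin D c" for x y
    using that by (rule closed)
  show "inv x \<in> adjoin D c" if x: "x \<in> adjoin D c" for x
  proof -
    obtain d and i :: nat where 1: "d \<in> D" "x = d \<otimes> c [^] i" using x by (auto simp: adjoin_def)
    \<comment> \<open>The inverse of the \<open>i\<close>-th power of \<open>c\<close> is its power with exponent \<open>i * (n - 1)\<close>.\<close>
    have "i * (n - 1) + i = n * i" using n(2) by (cases n) auto
    then have "c [^] (i * (n - 1)) \<otimes> c [^] i = \<one>"
      using c(1) n(1) nat_pow_pow[of c n i] by (simp add: nat_pow_mult)
    then have "inv (c [^] i) = c [^] (i * (n - 1))"
      using c(1) by (simp add: inv_equality)
    then have "inv x = c [^] (i * (n - 1)) \<otimes> inv d"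
      using 1 c(1) by (simp add: inv_mult_group)
    moreover have "c [^] (i * (n - 1)) \<in> adjoin D c"
    proof -
      have "c [^] (i * (n - 1)) = \<one> \<otimes> c [^] (i * (n - 1))" using c(1) by simp
      then show ?thesis using D.one_closed unfolding adjoin_def by blast
    qed
    moreover have "inv d \<in> adjoin D c" using 1 subset_adjoin[OF D] by blast
    ultimately show ?thesis using closed by simp
  qed
qed

lemma finite_adjoin:
  assumes "finite D" "c \<in> carrier G" "c [^] (n::nat) = \<one>" "n > 0"
  shows "finite (adjoin D c)"
proof (rule finite_subset)
  have "c [^] i = c [^] (i mod n)" for i
  proof -
    have "c [^] i = c [^] (n * (i div n)) \<otimes> c [^] (i mod n)"
      using assms(2) by (simp add: nat_pow_mult)
    then show ?thesis using assms(2,3) by (simp flip: nat_pow_pow)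
  qed
  then show "adjoin D c \<subseteq> (\<lambda>(d, i). d \<otimes> c [^] i) ` (D \<times> {..<n})"
    using mod_less_divisor[OF assms(4)] unfolding adjoin_def image_def
    by clarsimp (metis lessThan_iff mem_Sigma_iff)
  show "finite ((\<lambda>(d, i). d \<otimes> c [^] i) ` (D \<times> {..<n}))" using assms(1) by simp
qed

section \<open>Quadratically closed \<open>2\<close>-subgroups\<close>

text \<open>The first-order substitute for maximality among \<open>2\<close>-subgroups: for a finite subgroup \<open>U\<close> it means
  that \<open>U\<close> has index \<open>2\<close> in no subgroup, or that the quotient of its normaliser by \<open>U\<close> has no
  involution. An inclusion suffices for \<open>z\<close> to normalise \<open>U\<close>, because \<open>U\<close> is finite.\<close>

definition no_quadratic_extension :: "'a set \<Rightarrow> bool" where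
  "no_quadratic_extension U \<longleftrightarrow>
     (\<forall>z \<in> carrier G. z \<otimes> z \<in> U \<and> (\<forall>u \<in> U. z \<otimes> u \<otimes> inv z \<in> U) \<longrightarrow> z \<in> U)"

text \<open>All squares of elements of \<open>adjoin S z\<close> lie in \<open>S\<close>, so \<open>adjoin S z\<close> is a \<open>2\<close>-subgroup above \<open>S\<close>.\<close>

lemma sylow_two_subgroup_no_quadratic_extension:
  assumes "sylow_two_subgroup G S"
  shows "no_quadratic_extension S"
  unfolding no_quadratic_extension_def
proof (intro ballI impI)
  fix z assume z: "z \<in> carrier G" and "z \<otimes> z \<in> S \<and> (\<forall>u \<in> S. z \<otimes> u \<otimes> inv z \<in> S)"
  then have zz: "z \<otimes> z \<in> S" and nz: "\<And>u. u \<in> S \<Longrightarrow> z \<otimes> u \<otimes> inv z \<in> S" by auto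
  have two: "two_subgroup G S" and max: "\<And>Q. two_subgroup G Q \<Longrightarrow> S \<subseteq> Q \<Longrightarrow> Q = S"
    using assms by (auto simp: sylow_two_subgroup_def)
  have S: "subgroup S G" using two by (rule two_subgroup_imp_subgroup)
  have root: "\<exists>n::nat. x [^] (2 ^ n :: nat) = \<one>" if "x \<otimes> x \<in> S" "x \<in> carrier G" for x
  proof -
    obtain n :: nat where "(x \<otimes> x) [^] (2 ^ n :: nat) = \<one>" using two \<open>x \<otimes> x \<in> S\<close> by (auto simp: two_subgroup_iff)
    moreover have "x \<otimes> x = x [^] (2::nat)" using \<open>x \<in> carrier G\<close> by (simp add: numeral_2_eq_2)
    ultimately have "x [^] (2 ^ Suc n :: nat) = \<one>" using \<open>x \<in> carrier G\<close> by (simp add: nat_pow_pow)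
    then show ?thesis by blast
  qed
  obtain n :: nat where n: "z [^] (2 ^ n :: nat) = \<one>" using root[OF zz z] by blast
  have sub: "subgroup (adjoin S z) G" using subgroup_adjoin[OF S z nz n] by simp
  have "x \<otimes> x \<in> S" if x: "x \<in> adjoin S z" for x
  proof -
    obtain d and i :: nat where 1: "d \<in> S" "x = d \<otimes> z [^] i" using x by (auto simp: adjoin_def)
    have "z [^] (i + i) = (z \<otimes> z) [^] i"
      using z by (simp add: nat_pow_mult pow_mult_distrib)
    then show ?thesis
      unfolding 1 adjoin_mult[OF S z 1(1) 1(1)]
      using nat_pow_normalizes[OF S z nz 1(1)] 1(1) zz S
      by (simp add: nat_pow_in_subgroup subgroup.m_closed)
  qed
  then have "two_subgroup G (adjoin S z)"
    using sub root subgroup.mem_carrier[OF sub] by (simp add: two_subgroup_iff)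
  then have "adjoin S z = S" using max subset_adjoin[OF S] by blast
  then show "z \<in> S" using in_adjoin[OF S z] by simp
qed

text \<open>Some Sylow subgroup \<open>T'\<close> of odd index contains \<open>U\<close>, as \<open>U\<close> is conjugate into any of them. By
  normaliser growth \<open>U\<close> cannot be proper in \<open>T'\<close>, so \<open>U\<close> itself has odd index.\<close>

lemma finite_group_conj_into:
  assumes fin: "finite (carrier G)" and U: "two_subgroup G U" "no_quadratic_extension U"
    and Y: "two_subgroup G Y"
  shows "\<exists>g \<in> carrier G. \<forall>y \<in> Y. g \<otimes> y \<otimes> inv g \<in> U"
proof -
  have finite_sub: "finite P" if "subgroup P G" for P
    using that fin finite_subset subgroup.subset by metis
  have sU: "subgroup U G" and sY: "subgroup Y G"
    using U(1) Y by (auto intro: two_subgroup_imp_subgroup)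
  have pos: "order G > 0" using fin order_gt_0_iff_finite by blast
  define a where "a = multiplicity 2 (order G)"
  obtain m where m: "order G = 2 ^ a * m" "odd m"
    using pos multiplicity_decompose'[of "order G" "2::nat"] by (auto simp: a_def mult.commute)
  obtain T where T: "subgroup T G" "card T = 2 ^ a"
    using sylow_thm[OF two_is_prime_nat group_axioms m(1) fin] by blast
  interpret T: group "G\<lparr>carrier := T\<rparr>" using T(1) by (rule subgroup_imp_group)
  have two_T: "two_subgroup G T"
    using T T.pow_order_eq_1 by (auto simp: two_subgroup_iff order_def simp flip: nat_pow_consistent)
  have odd_index: "odd (card (rcosets P))" if "subgroup P G" "card P = 2 ^ a" for P
    using lagrange[OF that(1)] that(2) m by simp
  obtain h where h: "h \<in> carrier G" "\<And>u. u \<in> U \<Longrightarrow> h \<otimes> u \<otimes> inv h \<in> T"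
    using conj_into_odd_index[OF T(1) odd_index[OF T] U(1) finite_sub[OF sU]] by blast
  define T' where "T' = (\<lambda>t. inv h \<otimes> t \<otimes> inv (inv h)) ` T"
  have two_T': "two_subgroup G T'" using two_subgroup_conj[OF two_T, of "inv h"] h(1) by (simp add: T'_def)
  have sT': "subgroup T' G" using two_T' by (rule two_subgroup_imp_subgroup)
  have "inj_on (\<lambda>t. inv h \<otimes> t \<otimes> inv (inv h)) T"
    using subgroup.mem_carrier[OF T(1)] h(1) by (auto simp: inj_on_def)
  then have "card T' = 2 ^ a" using T(2) by (simp add: T'_def card_image)
  moreover have "U \<subseteq> T'"
  proof
    fix u assume u: "u \<in> U"
    then have "u = inv h \<otimes> (h \<otimes> u \<otimes> inv h) \<otimes> inv (inv h)"
      using h(1) subgroup.mem_carrier[OF sU] by (simp add: m_assoc inv_solve_left)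
    then show "u \<in> T'" unfolding T'_def using h(2)[OF u] by blast
  qed
  moreover have "\<not> U \<subset> T'"
  proof
    assume "U \<subset> T'"
    then obtain z where "z \<in> T' - U" "z \<otimes> z \<in> U" "\<forall>u \<in> U. z \<otimes> u \<otimes> inv z \<in> U"
      using two_subgroup_normalizer_growth[OF two_T' finite_sub[OF sT'] sU] by blast
    moreover from calculation have "z \<in> carrier G" using subgroup.mem_carrier[OF sT'] by blast
    ultimately show False
      using U(2) unfolding no_quadratic_extension_def by blast
  qed
  ultimately have "card U = 2 ^ a" by (metis psubsetI)
  then show ?thesis
    by (rule conj_into_odd_index[OF sU odd_index[OF sU] Y finite_sub[OF sY]])
qed

section \<open>\<open>2\<close>-groups with bounded finite subgroups\<close>

text \<open>Modulo \<open>D\<close> the elements \<open>a\<close> and \<open>b\<close> are involutions and \<open>c = a \<otimes> b\<close> is a rotation of finite order, which \<open>a\<close>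
  inverts. So the join arises by adjoining first \<open>c\<close> and then \<open>a\<close>.\<close>

lemma finite_two_subgroup_dihedral_join:
  assumes P: "two_subgroup G P" and D: "subgroup D G" "finite D" "D \<subseteq> P"
    and a: "a \<in> P" "a \<otimes> a \<in> D" "\<And>d. d \<in> D \<Longrightarrow> a \<otimes> d \<otimes> inv a \<in> D"
    and b: "b \<in> P" "b \<otimes> b \<in> D" "\<And>d. d \<in> D \<Longrightarrow> b \<otimes> d \<otimes> inv b \<in> D"
  shows "\<exists>H. subgroup H G \<and> finite H \<and> H \<subseteq> P \<and> D \<subseteq> H \<and> a \<in> H \<and> b \<in> H"
proof -
  have sP: "subgroup P G" using P by (rule two_subgroup_imp_subgroup)
  interpret P: subgroup P G by fact
  interpret D: subgroup D G by fact
  have aG: "a \<in> carrier G" and bG: "b \<in> carrier G" using a(1) b(1) by auto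
  define c where "c = a \<otimes> b"
  have c: "c \<in> P" "c \<in> carrier G" using a(1) b(1) by (auto simp: c_def)
  obtain n k :: nat where n: "c [^] (2 ^ n :: nat) = \<one>" and k: "a [^] (2 ^ k :: nat) = \<one>"
    using P c(1) a(1) unfolding two_subgroup_iff by meson
  have cD: "c \<otimes> d \<otimes> inv c \<in> D" if "d \<in> D" for d
  proof -
    have "c \<otimes> d \<otimes> inv c = a \<otimes> (b \<otimes> d \<otimes> inv b) \<otimes> inv a"
      using that aG bG by (simp add: c_def m_assoc inv_mult_group)
    then show ?thesis using a(3) b(3) that by simp
  qed
  define C where "C = adjoin D c"
  have sC: "subgroup C G" unfolding C_def using subgroup_adjoin[OF D(1) c(2) cD n] by simp
  interpret C: subgroup C G by fact
  have DC: "D \<subseteq> C" and cC: "c \<in> C"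
    unfolding C_def using subset_adjoin[OF D(1)] in_adjoin[OF D(1) c(2)] by auto
  have finC: "finite C" unfolding C_def using finite_adjoin[OF D(2) c(2) n] by simp
  have CP: "C \<subseteq> P" unfolding C_def using adjoin_subset[OF sP D(3) c(1)] .
  \<comment> \<open>The dihedral relation, up to factors in \<open>D\<close>.\<close>
  have "a \<otimes> c \<otimes> inv a = (a \<otimes> a) \<otimes> (b \<otimes> b) \<otimes> inv c"
    using aG bG by (simp add: c_def m_assoc inv_mult_group flip: m_assoc[of b "inv b"])
  then have ac: "a \<otimes> c \<otimes> inv a \<in> C" using a(2) b(2) DC cC by auto
  have aC: "a \<otimes> x \<otimes> inv a \<in> C" if x: "x \<in> C" for x
  proof -
    obtain d and i :: nat where 1: "d \<in> D" "x = d \<otimes> c [^] i" using x by (auto simp: C_def adjoin_def)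
    have cancel: "inv a \<otimes> (a \<otimes> y) = y" if "y \<in> carrier G" for y
      using that aG by (simp flip: m_assoc)
    have "a \<otimes> x \<otimes> inv a = (a \<otimes> d \<otimes> inv a) \<otimes> (a \<otimes> c \<otimes> inv a) [^] i"
      using 1 aG c(2) unfolding conj_nat_pow[OF aG c(2)] by (simp add: m_assoc cancel)
    then show ?thesis
      using a(3)[OF 1(1)] DC ac nat_pow_in_subgroup[OF sC] by auto
  qed
  define H where "H = adjoin C a"
  have sH: "subgroup H G" unfolding H_def using subgroup_adjoin[OF sC aG aC k] by simp
  have CH: "C \<subseteq> H" and aH: "a \<in> H"
    unfolding H_def using subset_adjoin[OF sC] in_adjoin[OF sC aG] by auto
  have "b = inv a \<otimes> c" using aG bG by (simp add: c_def m_assoc[symmetric])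
  then have "b \<in> H" using sH CH aH cC by (auto simp: subgroup.m_closed subgroup.m_inv_closed)
  moreover have "finite H" unfolding H_def using finite_adjoin[OF finC aG k] by simp
  moreover have "H \<subseteq> P" unfolding H_def using adjoin_subset[OF sP CP a(1)] .
  ultimately show ?thesis using sH CH aH DC by blast
qed

text \<open>In a \<open>2\<close>-group that is not known to be locally finite, two finite subgroups \<open>F\<close> and \<open>F'\<close> may
  generate an infinite one. Passing to elements that are involutions modulo \<open>F \<inter> F'\<close> avoids this: their
  dihedral join is finite, and it contradicts the maximality of \<open>F \<inter> F'\<close>.\<close>

lemma finite_two_subgroup_if_bounded:
  assumes P: "two_subgroup G P"
    and bound: "\<And>F. subgroup F G \<Longrightarrow> finite F \<Longrightarrow> F \<subseteq> P \<Longrightarrow> card F \<le> N"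
  shows "finite P"
proof -
  have sP: "subgroup P G" using P by (rule two_subgroup_imp_subgroup)
  define fin_sub where "fin_sub F \<longleftrightarrow> subgroup F G \<and> finite F \<and> F \<subseteq> P" for F
  have one: "fin_sub {\<one>}"
    using sP by (auto simp: fin_sub_def triv_subgroup subgroup.one_closed)
  obtain F where F: "fin_sub F" and F_max: "\<And>F'. fin_sub F' \<Longrightarrow> card F' \<le> card F"
    using ex_has_greatest_nat[of fin_sub "{\<one>}" card "Suc N"] one bound by (auto simp: fin_sub_def less_Suc_eq_le)
  have "P \<subseteq> F"
  proof (rule ccontr)
    assume "\<not> P \<subseteq> F"
    then obtain x where x: "x \<in> P" "x \<notin> F" by blast
    have xG: "x \<in> carrier G" using x(1) sP subgroup.mem_carrier by metis
    obtain n :: nat where n: "x [^] (2 ^ n :: nat) = \<one>" using P x by (auto simp: two_subgroup_iff)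
    \<comment> \<open>The cyclic group generated by \<open>x\<close> shows that candidates for \<open>F'\<close> exist.\<close>
    have "fin_sub (adjoin {\<one>} x)"
      using subgroup_adjoin[OF triv_subgroup xG _ n] finite_adjoin[OF _ xG n, of "{\<one>}"]
        adjoin_subset[OF sP _ x(1), of "{\<one>}"] sP xG
      by (auto simp: fin_sub_def subgroup.one_closed)
    moreover have "\<not> adjoin {\<one>} x \<subseteq> F"
      using in_adjoin[OF triv_subgroup xG] x(2) by blast
    moreover have "card (F \<inter> E) < Suc (card F)" for E
      using F by (simp add: fin_sub_def card_mono less_Suc_eq_le)
    ultimately have "\<exists>F'. (fin_sub F' \<and> \<not> F' \<subseteq> F) \<and>
        (\<forall>E. fin_sub E \<and> \<not> E \<subseteq> F \<longrightarrow> card (F \<inter> E) \<le> card (F \<inter> F'))"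
      by (intro ex_has_greatest_nat[of _ "adjoin {\<one>} x" _ "Suc (card F)"]) auto
    then obtain F' where F': "fin_sub F'" "\<not> F' \<subseteq> F"
      and F'_max: "\<And>E. fin_sub E \<Longrightarrow> \<not> E \<subseteq> F \<Longrightarrow> card (F \<inter> E) \<le> card (F \<inter> F')"
      by blast
    define D where "D = F \<inter> F'"
    have D: "subgroup D G" "finite D" "D \<subseteq> P"
      using F F' by (auto simp: D_def fin_sub_def subgroups_Inter_pair)
    have "D \<noteq> F"
    proof
      assume "D = F"
      then have "F \<subset> F'" using F'(2) by (auto simp: D_def)
      then have "card F < card F'" using F'(1) psubset_card_mono by (auto simp: fin_sub_def)
      then show False using F_max[OF F'(1)] by simp
    qed
    then have DF: "D \<subset> F" and DF': "D \<subset> F'" using F'(2) by (auto simp: D_def)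
    have two: "two_subgroup G F" "two_subgroup G F'"
      using two_subgroup_subset[OF P] F F'(1) by (auto simp: fin_sub_def)
    obtain a where a: "a \<in> F - D" "a \<otimes> a \<in> D" "\<And>d. d \<in> D \<Longrightarrow> a \<otimes> d \<otimes> inv a \<in> D"
      using two_subgroup_normalizer_growth[OF two(1) _ D(1) DF] F by (auto simp: fin_sub_def)
    obtain b where b: "b \<in> F' - D" "b \<otimes> b \<in> D" "\<And>d. d \<in> D \<Longrightarrow> b \<otimes> d \<otimes> inv b \<in> D"
      using two_subgroup_normalizer_growth[OF two(2) _ D(1) DF'] F' by (auto simp: fin_sub_def)
    have "a \<in> P" "b \<in> P" using a(1) b(1) F F' by (auto simp: fin_sub_def)
    then obtain H where H: "subgroup H G" "finite H" "H \<subseteq> P" "D \<subseteq> H" "a \<in> H" "b \<in> H"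
      using finite_two_subgroup_dihedral_join[OF P D _ a(2,3) _ b(2,3)] by blast
    have "\<not> H \<subseteq> F" using H(6) b(1) by (auto simp: D_def)
    then have "card (F \<inter> H) \<le> card D" using F'_max H by (simp add: fin_sub_def D_def)
    moreover have "D \<subset> F \<inter> H" using H(4,5) a(1) DF by auto
    then have "card D < card (F \<inter> H)" using H(2) psubset_card_mono by (metis finite_Int)
    ultimately show False by simp
  qed
  then show ?thesis using F finite_subset by (auto simp: fin_sub_def)
qed

end

section \<open>Transfer from finite groups\<close>

text \<open>Satisfaction under all assignments is already universally quantified over the free variables.\<close>

lemma models_FAll:
  fixes G :: "('a, 'b) monoid_scheme"
  shows "models G (FAll i p) \<longleftrightarrow> models G p"
proof
  assume L: "models G (FAll i p)"
  show "models G p"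
    unfolding models_def
  proof (intro allI impI)
    fix e :: "nat \<Rightarrow> 'a" assume e: "range e \<subseteq> carrier G"
    then have "\<forall>a \<in> carrier G. sat G (e(i := a)) p" "e i \<in> carrier G"
      using L by (auto simp: models_def)
    then show "sat G e p" by (metis fun_upd_triv)
  qed
next
  assume R: "models G p"
  show "models G (FAll i p)"
    unfolding models_def sat.simps
  proof (intro allI impI ballI)
    fix e :: "nat \<Rightarrow> 'a" and a assume "range e \<subseteq> carrier G" "a \<in> carrier G"
    then have "range (e(i := a)) \<subseteq> carrier G" by auto
    then show "sat G (e(i := a)) p" using R by (auto simp: models_def)
  qed
qed

lemma models_closure:
  "models G (foldr FAll is p) \<longleftrightarrow> models G p"
  by (induction "is") (auto simp: models_FAll)

lemma free_vars_closure: "free_vars (foldr FAll is p) = free_vars p - set is"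
  by (induction "is") auto

lemma finite_free_vars: "finite (free_vars p)"
proof -
  have "finite (term_vars t)" for t by (induction t) auto
  then show ?thesis by (induction p) auto
qed

text \<open>Passing to the universal closure lets formulas with free variables be transferred; the free
  variables then serve as names for the elements of finite subsets.\<close>

lemma pseudofinite_models:
  assumes "pseudofinite_group G"
    and fin: "\<And>H :: nat monoid. group H \<Longrightarrow> finite (carrier H) \<Longrightarrow> models H p"
  shows "models G p"
proof -
  obtain "is" where "is": "set is = free_vars p"
    using finite_free_vars finite_list by blast
  have "sentence (foldr FAll is p)"
    by (simp add: sentence_def free_vars_closure "is")
  moreover have "true_in_finite_groups (foldr FAll is p)"
    using fin by (simp add: true_in_finite_groups_def models_closure)
  ultimately have "models G (foldr FAll is p)"
    using assms(1) by (simp add: pseudofinite_group_def)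
  then show ?thesis
    using assms(1) by (simp add: models_closure pseudofinite_group_def)
qed

section \<open>The first-order formulas\<close>

definition FImp :: "gform \<Rightarrow> gform \<Rightarrow> gform" where
  "FImp p q = FNeg (FConj p (FNeg q))"

definition FEx :: "nat \<Rightarrow> gform \<Rightarrow> gform" where
  "FEx i p = FNeg (FAll i (FNeg p))"

definition FConjs :: "gform list \<Rightarrow> gform" where
  "FConjs ps = foldr FConj ps (FEq TOne TOne)"

definition FMem :: "gterm \<Rightarrow> nat list \<Rightarrow> gform" where
  "FMem t is = FNeg (FConjs (map (\<lambda>i. FNeg (FEq t (TVar i))) is))"

lemma sat_FImp [simp]: "sat G e (FImp p q) \<longleftrightarrow> (sat G e p \<longrightarrow> sat G e q)"
  by (simp add: FImp_def)

lemma sat_FEx [simp]: "sat G e (FEx i p) \<longleftrightarrow> (\<exists>a \<in> carrier G. sat G (e(i := a)) p)"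
  by (simp add: FEx_def)

lemma sat_FConjs [simp]: "sat G e (FConjs ps) \<longleftrightarrow> (\<forall>p \<in> set ps. sat G e p)"
  by (induction ps) (auto simp: FConjs_def)

lemma sat_FMem [simp]: "sat G e (FMem t is) \<longleftrightarrow> term_val G e t \<in> e ` set is"
  by (auto simp: FMem_def)

fun TSq :: "nat \<Rightarrow> gterm \<Rightarrow> gterm" where
  "TSq 0 t = t"
| "TSq (Suc n) t = TSq n (TMult t t)"

lemma (in group) term_val_TSq:
  assumes "range e \<subseteq> carrier G"
  shows "term_val G e (TSq n t) = term_val G e t [^] (2 ^ n :: nat)"
proof (induction n arbitrary: t)
  case 0
  then show ?case using term_val_closed[OF group_axioms assms] by simp
next
  case (Suc n)
  then show ?case
    using term_val_closed[OF group_axioms assms, of t]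
    by (simp add: pow_mult_distrib nat_pow_mult mult_2)
qed

text \<open>A subgroup is given by variables that enumerate its elements. The exponent is bounded by the
  parameter \<open>n\<close>, because being of \<open>2\<close>-power order without a bound is not first-order.\<close>

definition FTwoSubgroup :: "nat \<Rightarrow> nat list \<Rightarrow> gform" where
  "FTwoSubgroup n is =
     FConjs (FMem TOne is
       # map (\<lambda>i. FMem (TInv (TVar i)) is) is
       @ map (\<lambda>i. FEq (TSq n (TVar i)) TOne) is
       @ concat (map (\<lambda>i. map (\<lambda>j. FMem (TMult (TVar i) (TVar j)) is) is) is))"

lemma (in group) sat_FTwoSubgroup:
  assumes e: "range e \<subseteq> carrier G"
  shows "sat G e (FTwoSubgroup n is) \<longleftrightarrow>
    subgroup (e ` set is) G \<and> (\<forall>x \<in> e ` set is. x [^] (2 ^ n :: nat) = \<one>)"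
  using e
  by (auto simp: FTwoSubgroup_def term_val_TSq ball_Un subgroup_def)

definition FConjugates :: "gterm \<Rightarrow> nat list \<Rightarrow> nat list \<Rightarrow> gform" where
  "FConjugates t is js = FConjs (map (\<lambda>i. FMem (TMult (TMult t (TVar i)) (TInv t)) js) is)"

lemma sat_FConjugates [simp]:
  "sat G e (FConjugates t is js) \<longleftrightarrow>
    (\<forall>x \<in> e ` set is. term_val G e t \<otimes>\<^bsub>G\<^esub> x \<otimes>\<^bsub>G\<^esub> inv\<^bsub>G\<^esub> (term_val G e t) \<in> e ` set js)"
  by (auto simp: FConjugates_def)

text \<open>The bound variable \<open>z\<close> must not occur in \<open>is\<close>; likewise for the variable of \<open>FConjInto\<close>.\<close>

definition FNoQuadraticExtension :: "nat \<Rightarrow> nat list \<Rightarrow> gform" where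
  "FNoQuadraticExtension z is =
     FAll z (FImp (FConj (FMem (TMult (TVar z) (TVar z)) is) (FConjugates (TVar z) is is))
       (FMem (TVar z) is))"

lemma image_fun_upd_fresh: "z \<notin> A \<Longrightarrow> e(z := a) ` A = e ` A"
  by (auto simp: image_iff)

lemma (in group) sat_FNoQuadraticExtension:
  assumes "z \<notin> set is"
  shows "sat G e (FNoQuadraticExtension z is) \<longleftrightarrow> no_quadratic_extension (e ` set is)"
  unfolding FNoQuadraticExtension_def no_quadratic_extension_def sat.simps sat_FImp sat_FMem
    sat_FConjugates term_val.simps fun_upd_same image_fun_upd_fresh[OF assms] ..

definition FConjInto :: "nat \<Rightarrow> nat list \<Rightarrow> nat list \<Rightarrow> gform" where
  "FConjInto z is js = FEx z (FConjugates (TVar z) is js)"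

lemma sat_FConjInto:
  assumes "z \<notin> set is" "z \<notin> set js"
  shows "sat G e (FConjInto z is js) \<longleftrightarrow>
    (\<exists>g \<in> carrier G. \<forall>x \<in> e ` set is. g \<otimes>\<^bsub>G\<^esub> x \<otimes>\<^bsub>G\<^esub> inv\<^bsub>G\<^esub> g \<in> e ` set js)"
  unfolding FConjInto_def sat_FEx sat_FConjugates term_val.simps fun_upd_same
    image_fun_upd_fresh[OF assms(1)] image_fun_upd_fresh[OF assms(2)] ..

section \<open>Sylow \<open>2\<close>-subgroups of pseudofinite groups\<close>

lemma (in group) finite_two_subgroup_exponent:
  assumes "two_subgroup G P" "finite P"
  shows "\<exists>n::nat. \<forall>x \<in> P. x [^] (2 ^ n :: nat) = \<one>"
proof -
  obtain n where n: "card P = 2 ^ n" using two_subgroup_card[OF assms] by blast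
  interpret P: group "G\<lparr>carrier := P\<rparr>"
    using assms(1) by (simp add: two_subgroup_def subgroup_imp_group)
  show ?thesis
    using P.pow_order_eq_1 n by (auto simp: order_def simp flip: nat_pow_consistent)
qed

text \<open>The formula \<open>p\<close> states \<open>finite_group_conj_into\<close> for subgroups listed by as many variables, and
  with the same bounds on exponents, as \<open>U\<close> and \<open>Y\<close>. Evaluating it at enumerations of \<open>U\<close> and \<open>Y\<close> gives the claim.\<close>

lemma pseudofinite_conj_into:
  fixes G (structure)
  assumes psf: "pseudofinite_group G"
    and U: "two_subgroup G U" "finite U" "group.no_quadratic_extension G U"
    and Y: "two_subgroup G Y" "finite Y"
  shows "\<exists>g \<in> carrier G. \<forall>y \<in> Y. g \<otimes> y \<otimes> inv g \<in> U"
proof -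
  interpret group G using psf by (simp add: pseudofinite_group_def)
  obtain us where us: "set us = U" using finite_list[OF U(2)] by blast
  obtain ys where ys: "set ys = Y" using finite_list[OF Y(2)] by blast
  obtain m :: nat where m: "\<forall>x \<in> U. x [^] (2 ^ m :: nat) = \<one>"
    using finite_two_subgroup_exponent[OF U(1,2)] by blast
  obtain n :: nat where n: "\<forall>x \<in> Y. x [^] (2 ^ n :: nat) = \<one>"
    using finite_two_subgroup_exponent[OF Y] by blast
  \<comment> \<open>The first variables name \<open>U\<close>, the next ones \<open>Y\<close>, and \<open>l\<close> is left for bound variables.\<close>
  define l where "l = length us + length ys"
  define us_vars where "us_vars = [0..<length us]"
  define ys_vars where "ys_vars = [length us..<l]"
  define p where "p = FImp
    (FConjs [FTwoSubgroup m us_vars, FNoQuadraticExtension l us_vars, FTwoSubgroup n ys_vars])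
    (FConjInto l ys_vars us_vars)"
  have fresh: "l \<notin> set us_vars" "l \<notin> set ys_vars"
    by (auto simp: us_vars_def ys_vars_def l_def)
  have "models H p" if "group H" "finite (carrier H)" for H :: "nat monoid"
    unfolding models_def
  proof (intro allI impI)
    interpret H: group H by fact
    fix e :: "nat \<Rightarrow> nat" assume e: "range e \<subseteq> carrier H"
    show "sat H e p"
      using H.finite_group_conj_into[OF that(2), of "e ` set us_vars" "e ` set ys_vars"]
      unfolding p_def sat_FImp sat_FConjs list.set ball_simps(5,7) H.sat_FTwoSubgroup[OF e]
        H.sat_FNoQuadraticExtension[OF fresh(1)] sat_FConjInto[OF fresh(2,1)] H.two_subgroup_iff
      by blast
  qed
  then have G_p: "models G p" by (rule pseudofinite_models[OF psf])
  \<comment> \<open>From \<open>l\<close> on any value in the carrier will do.\<close>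
  define e where "e i = (if i < l then (us @ ys) ! i else \<one>)" for i
  have "U \<subseteq> carrier G" "Y \<subseteq> carrier G"
    using U(1) Y(1) by (auto dest: two_subgroup_imp_subgroup subgroup.subset)
  then have e: "range e \<subseteq> carrier G"
    using us ys nth_mem[of _ "us @ ys"] by (auto simp: e_def l_def)
  have "map e us_vars = us"
    by (rule nth_equalityI) (auto simp: us_vars_def e_def l_def nth_append)
  then have eU: "e ` set us_vars = U" using us by (metis set_map)
  have "map e ys_vars = ys"
    by (rule nth_equalityI) (auto simp: ys_vars_def e_def l_def nth_append)
  then have eY: "e ` set ys_vars = Y" using ys by (metis set_map)
  have "sat G e p" using G_p e by (simp add: models_def)
  then show ?thesis
    using U(1,3) Y(1) m n
    by (simp add: p_def sat_FTwoSubgroup[OF e] sat_FNoQuadraticExtension fresh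
        sat_FConjInto eU eY two_subgroup_imp_subgroup)
qed

text \<open>Finite \<open>2\<close>-subgroups are conjugate into \<open>S\<close>, so \<open>card S\<close> bounds their orders and every
  \<open>2\<close>-subgroup is finite. For a Sylow \<open>2\<close>-subgroup \<open>P\<close> the conjugate of \<open>S\<close> above
  \<open>P\<close> must then be \<open>P\<close>, and two conjugates of \<open>S\<close> are conjugate to each other.\<close>

lemma pseudofinite_finite_sylow_two_subgroups:
  fixes G (structure)
  assumes psf: "pseudofinite_group G" and S: "sylow_two_subgroup G S" "finite S"
  shows sylow_two_subgroups_conjugate:
      "sylow_two_subgroup G P \<Longrightarrow> sylow_two_subgroup G Q \<Longrightarrow> conjugate_in G P Q"
    and sylow_two_subgroups_finite: "sylow_two_subgroup G P \<Longrightarrow> finite P"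
proof -
  interpret group G using psf by (simp add: pseudofinite_group_def)
  have two_S: "two_subgroup G S" using S(1) by (simp add: sylow_two_subgroup_def)
  have into_S: "\<exists>g \<in> carrier G. \<forall>y \<in> Y. g \<otimes> y \<otimes> inv g \<in> S" if "two_subgroup G Y" "finite Y" for Y
    using pseudofinite_conj_into[OF psf two_S S(2)
        sylow_two_subgroup_no_quadratic_extension[OF S(1)] that] .
  have finite: "finite P" if P: "two_subgroup G P" for P
  proof (rule finite_two_subgroup_if_bounded[OF P])
    fix F assume F: "subgroup F G" "finite F" "F \<subseteq> P"
    then obtain g where g: "g \<in> carrier G" "\<forall>y \<in> F. g \<otimes> y \<otimes> inv g \<in> S"
      using into_S two_subgroup_subset[OF P] by blast
    have "inj_on (\<lambda>y. g \<otimes> y \<otimes> inv g) F"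
      using g(1) subgroup.mem_carrier[OF F(1)] by (auto simp: inj_on_def)
    then show "card F \<le> card S" using g(2) S(2) by (intro card_inj_on_le) auto
  qed
  have conj_S: "\<exists>g \<in> carrier G. P = (\<lambda>x. g \<otimes> x \<otimes> inv g) ` S"
    if P: "sylow_two_subgroup G P" for P
  proof -
    have two_P: "two_subgroup G P" and P_max: "\<And>Q. two_subgroup G Q \<Longrightarrow> P \<subseteq> Q \<Longrightarrow> Q = P"
      using P by (auto simp: sylow_two_subgroup_def)
    have P_carrier: "P \<subseteq> carrier G"
      using two_P by (auto dest: two_subgroup_imp_subgroup subgroup.subset)
    obtain g where g: "g \<in> carrier G" "\<forall>y \<in> P. g \<otimes> y \<otimes> inv g \<in> S"
      using into_S[OF two_P finite[OF two_P]] by blast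
    have "y = inv g \<otimes> (g \<otimes> y \<otimes> inv g) \<otimes> inv (inv g)" if "y \<in> P" for y
      using that P_carrier g(1) by (auto simp: m_assoc inv_solve_left subset_iff)
    then have "P \<subseteq> (\<lambda>x. inv g \<otimes> x \<otimes> inv (inv g)) ` S" using g(2) by blast
    then have "P = (\<lambda>x. inv g \<otimes> x \<otimes> inv (inv g)) ` S"
      using P_max two_subgroup_conj[OF two_S, of "inv g"] g(1) by (metis inv_closed)
    then show ?thesis using g(1) by blast
  qed
  show "conjugate_in G P Q" if "sylow_two_subgroup G P" "sylow_two_subgroup G Q"
  proof -
    obtain g h where g: "g \<in> carrier G" "P = (\<lambda>x. g \<otimes> x \<otimes> inv g) ` S"
      and h: "h \<in> carrier G" "Q = (\<lambda>x. h \<otimes> x \<otimes> inv h) ` S"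
      using conj_S[OF \<open>sylow_two_subgroup G P\<close>] conj_S[OF \<open>sylow_two_subgroup G Q\<close>] by blast
    have "S \<subseteq> carrier G" using two_S by (auto dest: two_subgroup_imp_subgroup subgroup.subset)
    then have "(h \<otimes> inv g) \<otimes> (g \<otimes> x \<otimes> inv g) \<otimes> inv (h \<otimes> inv g) = h \<otimes> x \<otimes> inv h" if "x \<in> S" for x
      using that g(1) h(1) by (simp add: subset_iff inv_mult_group m_assoc inv_solve_left')
    then have "Q = (\<lambda>y. (h \<otimes> inv g) \<otimes> y \<otimes> inv (h \<otimes> inv g)) ` P"
      unfolding g(2) h(2) image_image by (intro image_cong) auto
    then show ?thesis
      using g(1) h(1) unfolding conjugate_in_def conj_subset_eq_image by blast
  qed
  show "finite P" if "sylow_two_subgroup G P"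
    using finite that by (simp add: sylow_two_subgroup_def)
qed

theorem theorem3p3:
  fixes G :: "('a, 'b) monoid_scheme"
  assumes "pseudofinite_group G"
    and "mc_group G"
    and "\<exists>S. sylow_two_subgroup G S \<and> finite S"
  shows "(\<forall>P Q. sylow_two_subgroup G P \<and> sylow_two_subgroup G Q \<longrightarrow> conjugate_in G P Q) \<and>
         (\<forall>P. sylow_two_subgroup G P \<longrightarrow> finite P)"
  using assms pseudofinite_finite_sylow_two_subgroups[of G] by blast

end
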